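(* Let $\mathcal V$ be a finite-dimensional real inner product space with inner product $\langle\cdot,\cdot\rangle$ and induced norm $\|\cdot\|_2$, let $C\subseteq\mathcal V$ be nonempty, closed and convex, let $\gamma\in\mathbb R$, $h\in\mathcal V$, $Q_0>0$, and let $Q(z):=\frac12\|z\|_2^2+Q_0$ and $E_{\gamma,h}(x):=-\frac{\gamma+\langle h,x\rangle}{Q(x)}$. Let $u$ be a maximizer of $E_{\gamma,h}$ over $C$, and suppose $e:=E_{\gamma,h}(u)>0$. Then $$u=\widehat u(e):=P_C(y),\qquad y:=-e^{-1}h,$$ where $e$ is a solution of the univariate equation $\varphi(e)=0$ with $$\varphi(e):=e\left(\tfrac12\|\widehat u(e)\|_2^2+Q_0\right)+\gamma+\langle h,\widehat u(e)\rangle .$$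
   Context: $P_C(y):=\operatorname{argmin}_{x\in C}\frac12\|x-y\|_2^2$ denotes the orthogonal projection of $y\in\mathcal V$ onto $C$. For any $e>0$, $\widehat u(e):=P_C(-e^{-1}h)$. The dual space of $\mathcal V$ is identified with $\mathcal V$ via the inner product. *)

theory Defs
  imports "HOL-Analysis.Analysis"
begin

text \<open>
  Finite-dimensional inner product spaces are types of class real_inner satisfying
  \<open>finite_dim\<close>; unlike class euclidean_space this includes the zero space.
\<close>

definition finite_dim :: "'a::real_vector itself \<Rightarrow> bool" where
  "finite_dim _ \<longleftrightarrow> (\<exists>B::'a set. finite B \<and> span B = UNIV)"

text \<open>
  The library's \<open>closest_point\<close> is restricted to class heine_borel, hence the direct definition;
  the two agree where both make sense.
\<close>

definition proj :: "'a::real_inner set \<Rightarrow> 'a \<Rightarrow> 'a" where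
  "proj C y = arg_min_on (\<lambda>x. (1/2) * (norm (x - y))\<^sup>2) C"

lemma proj_eq_closest_point:
  fixes C :: "'a::{real_inner,heine_borel} set"
  shows "proj C y = closest_point C y"
proof -
  have "((1/2) * (norm (z - y))\<^sup>2 < (1/2) * (norm (x - y))\<^sup>2) \<longleftrightarrow> \<not> dist y x \<le> dist y z" for x z
    by (auto simp: dist_norm norm_minus_commute not_le power_strict_mono intro: power_less_imp_less_base)
  then show ?thesis
    unfolding proj_def arg_min_on_def arg_min_def is_arg_min_def closest_point_def
    by (intro arg_cong[where f = Eps] ext) auto
qed

definition uhat :: "'a::real_inner set \<Rightarrow> 'a \<Rightarrow> real \<Rightarrow> 'a" where
  "uhat C h e = proj C (- (inverse e *\<^sub>R h))"

definition Q :: "real \<Rightarrow> 'a::real_inner \<Rightarrow> real" where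
  "Q Q0 z = (1/2) * (norm z)\<^sup>2 + Q0"

definition E :: "real \<Rightarrow> real \<Rightarrow> 'a::real_inner \<Rightarrow> 'a \<Rightarrow> real" where
  "E Q0 \<gamma> h x = - ((\<gamma> + inner h x) / Q Q0 x)"

definition phi :: "'a::real_inner set \<Rightarrow> real \<Rightarrow> real \<Rightarrow> 'a \<Rightarrow> real \<Rightarrow> real" where
  "phi C Q0 \<gamma> h e =
     e * ((1/2) * (norm (uhat C h e))\<^sup>2 + Q0) + \<gamma> + inner h (uhat C h e)"

end

theory Submission
  imports Defs
begin

text \<open>
  The fractional objective is traded for a parametric one. With \<open>e\<close> the maximal value and
  \<open>Q > 0\<close>, the inequality \<open>E x \<le> e\<close> says exactly that the strongly convex quadratic
  \<open>F x = e * Q x + \<gamma> + \<langle>h, x\<rangle>\<close> is nonnegative on \<open>C\<close>, and \<open>E u = e\<close> says that \<open>F u = 0\<close>. So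
  \<open>u\<close> minimizes \<open>F\<close> over \<open>C\<close> with minimum value \<open>0\<close>. As \<open>e > 0\<close>, completing the square shows
  that \<open>F x\<close> equals \<open>e\<close> times half the squared distance from \<open>x\<close> to \<open>y = - h / e\<close>, plus a
  constant in \<open>x\<close> (\<open>parametric_complete_square\<close>). Hence \<open>u\<close> is a nearest point of \<open>C\<close> to \<open>y\<close>. By
  convexity it is the only one (\<open>proj_eqI\<close>), so it is the projection of \<open>y\<close>, and the equation
  \<open>\<phi> e = 0\<close> is \<open>F u = 0\<close> read at this point.
\<close>

text \<open>
  Two distinct nearest points would have a midpoint in \<open>C\<close> that is strictly nearer, by the
  parallelogram law; so the choice made by \<open>arg_min_on\<close> falls on \<open>u\<close>.
\<close>
lemma proj_eqI:
  fixes C :: "'a::real_inner set"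
  assumes "convex C" "u \<in> C" and nearest: "\<And>x. x \<in> C \<Longrightarrow> (norm (u - y))\<^sup>2 \<le> (norm (x - y))\<^sup>2"
  shows "proj C y = u"
proof -
  let ?f = "\<lambda>x. (1/2) * (norm (x - y))\<^sup>2"
  have "is_arg_min ?f (\<lambda>x. x \<in> C) u"
    using \<open>u \<in> C\<close> nearest by (simp add: is_arg_min_linorder)
  then have "is_arg_min ?f (\<lambda>x. x \<in> C) (proj C y)"
    unfolding proj_def arg_min_on_def arg_min_def by (rule someI)
  then have v: "proj C y \<in> C" "(norm (proj C y - y))\<^sup>2 \<le> (norm (u - y))\<^sup>2"
    using \<open>u \<in> C\<close> by (auto simp: is_arg_min_linorder)
  define v where "v = proj C y"
  define m where "m = (1/2) *\<^sub>R u + (1/2) *\<^sub>R v"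
  have "m \<in> C"
    unfolding m_def v_def using assms(1,2) v(1) by (intro convexD) auto
  have "4 * (norm (m - y))\<^sup>2 + (norm (u - v))\<^sup>2 = 2 * (norm (u - y))\<^sup>2 + 2 * (norm (v - y))\<^sup>2"
    unfolding m_def power2_norm_eq_inner
    by (simp add: inner_simps inner_commute algebra_simps)
  then have "(norm (u - v))\<^sup>2 \<le> 0"
    using nearest[OF \<open>m \<in> C\<close>] v(2) unfolding v_def by linarith
  then show ?thesis by (simp add: v_def)
qed

lemma parametric_complete_square:
  fixes h x :: "'a::real_inner"
  assumes "e \<noteq> 0"
  shows "e * Q Q0 x + \<gamma> + inner h x =
    e * ((1/2) * (norm (x - (- (inverse e *\<^sub>R h))))\<^sup>2)
      + (e * Q0 + \<gamma> - (norm h)\<^sup>2 / (2 * e))"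
  using assms unfolding Q_def power2_norm_eq_inner
  by (simp add: inner_simps inner_commute field_simps)

lemma Q_pos: "Q0 > 0 \<Longrightarrow> Q Q0 x > 0"
  unfolding Q_def by (simp add: add_nonneg_pos)

theorem theorem3p3:
  fixes C :: "'a::real_inner set"
    and \<gamma> Q0 e :: real
    and h u y :: 'a
  assumes "finite_dim TYPE('a)"
    and "C \<noteq> {}" and "closed C" and "convex C"
    and "Q0 > 0"
    and "is_arg_max (E Q0 \<gamma> h) (\<lambda>x. x \<in> C) u"
    and "e = E Q0 \<gamma> h u" and "e > 0"
    and "y = - (inverse e *\<^sub>R h)"
  shows "u = uhat C h e \<and> uhat C h e = proj C y \<and> phi C Q0 \<gamma> h e = 0"
proof -
  let ?F = "\<lambda>x. e * Q Q0 x + \<gamma> + inner h x"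
  have "u \<in> C" and max: "\<And>x. x \<in> C \<Longrightarrow> E Q0 \<gamma> h x \<le> e"
    using assms(6,7) by (auto simp: is_arg_max_linorder)
  have F_nonneg: "?F x \<ge> 0" if "x \<in> C" for x
    using max[OF that] Q_pos[OF \<open>Q0 > 0\<close>, of x] by (simp add: E_def field_simps)
  have F_u: "?F u = 0"
    using Q_pos[OF \<open>Q0 > 0\<close>, of u] by (simp add: \<open>e = E Q0 \<gamma> h u\<close> E_def)
  have "proj C y = u"
  proof (rule proj_eqI[OF \<open>convex C\<close> \<open>u \<in> C\<close>])
    fix x assume "x \<in> C"
    then have "?F u \<le> ?F x"
      using F_nonneg F_u by simp
    then have "e * (norm (u - y))\<^sup>2 \<le> e * (norm (x - y))\<^sup>2"
      using \<open>e > 0\<close> by (simp add: parametric_complete_square \<open>y = _\<close>)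
    then show "(norm (u - y))\<^sup>2 \<le> (norm (x - y))\<^sup>2"
      using \<open>e > 0\<close> by simp
  qed
  then have "uhat C h e = u"
    by (simp add: uhat_def \<open>y = _\<close>)
  with \<open>proj C y = u\<close> F_u show ?thesis
    by (simp add: phi_def Q_def)
qed

end
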